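(* Let $\mathcal{A}$ be a Boolean tensor of size $I_1\times\cdots\times I_M\times J_1\times\cdots\times J_N$ with weight $w(\mathcal{A})\leq 1$. Then $\mathcal{A}$ is regular.
   Context: A Boolean tensor is an array with entries in $\{0,1\}$; entries are added and multiplied by the rules of the binary Boolean algebra ($1+1=1$, otherwise as usual). For $\mathcal{A}$ of size $I_1\times\cdots\times I_M\times J_1\times\cdots\times J_N$ and $\mathcal{B}$ of size $J_1\times\cdots\times J_N\times K_1\times\cdots\times K_L$, the Einstein product $\mathcal{A}*_N\mathcal{B}$ has entries $\sum_{j_1,\dots,j_N}a_{i_1\ldots i_Mj_1\ldots j_N}b_{j_1\ldots j_Nk_1\ldots k_L}$ (Boolean sum); the subscript of $*$ is the number of contracted indices. The weight $w(\mathcal{A})$ is the total number of nonzero entries of $\mathcal{A}$. $\mathcal{A}$ is regular if there is a Boolean tensor $\mathcal{X}$ of size $J_1\times\cdots\times J_N\times I_1\times\cdots\times I_M$ with $\mathcal{A}*_N\mathcal{X}*_M\mathcal{A}=\mathcal{A}$. *)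

theory Defs
  imports "HOL-Library.FuncSet"
begin

text \<open>The binary Boolean algebra: \<open>bool\<close> as a semiring in which \<open>1 + 1 = 1\<close>.\<close>

instantiation bool :: comm_semiring_1
begin
definition "0 \<longleftrightarrow> False"
definition "1 \<longleftrightarrow> True"
definition "p + q \<longleftrightarrow> p \<or> q" for p q :: bool
definition "p * q \<longleftrightarrow> p \<and> q" for p q :: bool
instance
  by standard (auto simp: zero_bool_def one_bool_def plus_bool_def times_bool_def)
end

lemma sum_bool_iff:
  fixes f :: "'a \<Rightarrow> bool"
  assumes "finite S"
  shows "sum f S \<longleftrightarrow> (\<exists>x\<in>S. f x)"
  using assms by (induction S rule: finite_induct) (auto simp: zero_bool_def plus_bool_def)

text \<open>
  The list \<open>[I\<^sub>1, \<dots>, I\<^sub>M]\<close> stands for the size \<open>I\<^sub>1 \<times> \<dots> \<times> I\<^sub>M\<close>, and the list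
  \<open>[i\<^sub>1, \<dots>, i\<^sub>M]\<close> with \<open>1 \<le> i\<^sub>m \<le> I\<^sub>m\<close> for a multi-index.
  The size \<open>I\<^sub>1 \<times> \<dots> \<times> I\<^sub>M \<times> J\<^sub>1 \<times> \<dots> \<times> J\<^sub>N\<close> is then \<open>I @ J\<close>.
\<close>

definition indices :: "nat list \<Rightarrow> nat list set" where
  "indices D = {l. list_all2 (\<lambda>i d. 1 \<le> i \<and> i \<le> d) l D}"

lemma finite_indices: "finite (indices D)"
proof (rule finite_subset)
  show "indices D \<subseteq> {l. set l \<subseteq> {0..Max (set D)} \<and> length l = length D}"
  proof
    fix l assume "l \<in> indices D"
    then have len: "length l = length D" and le: "\<And>k. k < length D \<Longrightarrow> l ! k \<le> D ! k"
      by (auto simp: indices_def list_all2_conv_all_nth)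
    have "l ! k \<le> Max (set D)" if "k < length D" for k
      using le[OF that] that by (meson List.finite_set Max_ge le_trans nth_mem)
    with len show "l \<in> {l. set l \<subseteq> {0..Max (set D)} \<and> length l = length D}"
      by (auto simp: set_conv_nth)
  qed
  show "finite {l. set l \<subseteq> {0..Max (set D)} \<and> length l = length D}"
    by (rule finite_lists_length_eq) simp
qed

text \<open>
  Tensors are extensional functions, so that equality of two tensors of the same size is
  equality of their entries.
\<close>

definition bool_tensors :: "nat list \<Rightarrow> (nat list \<Rightarrow> bool) set" where
  "bool_tensors D = indices D \<rightarrow>\<^sub>E {0, 1}"

text \<open>
  Einstein product of tensors of sizes \<open>I @ J\<close> and \<open>J @ K\<close>, contracting the \<open>length J\<close>
  indices ranging over \<open>J\<close>; see \<open>einstein_product_entry\<close> for the entrywise formula.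
\<close>

definition einstein_product ::
  "nat list \<Rightarrow> nat list \<Rightarrow> nat list \<Rightarrow> (nat list \<Rightarrow> bool) \<Rightarrow> (nat list \<Rightarrow> bool) \<Rightarrow> nat list \<Rightarrow> bool"
where
  "einstein_product I J K A B =
     (\<lambda>l\<in>indices (I @ K).
        \<Sum>j\<in>indices J. A (take (length I) l @ j) * B (j @ drop (length I) l))"

lemma einstein_product_entry:
  assumes "i \<in> indices I" "k \<in> indices K"
  shows "einstein_product I J K A B (i @ k) = (\<Sum>j\<in>indices J. A (i @ j) * B (j @ k))"
proof -
  have "length i = length I" using assms(1) by (simp add: indices_def list_all2_lengthD)
  moreover have "i @ k \<in> indices (I @ K)"
    using assms by (simp add: indices_def list_all2_appendI)
  ultimately show ?thesis by (simp add: einstein_product_def)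
qed

lemma einstein_product_in_bool_tensors: "einstein_product I J K A B \<in> bool_tensors (I @ K)"
  by (auto simp: einstein_product_def bool_tensors_def zero_bool_def one_bool_def)

definition weight :: "nat list \<Rightarrow> (nat list \<Rightarrow> bool) \<Rightarrow> nat" where
  "weight D A = card {l \<in> indices D. A l \<noteq> 0}"

definition regular :: "nat list \<Rightarrow> nat list \<Rightarrow> (nat list \<Rightarrow> bool) \<Rightarrow> bool" where
  "regular I J A \<longleftrightarrow>
     (\<exists>X\<in>bool_tensors (J @ I). einstein_product I I J (einstein_product I J I A X) A = A)"

end

theory Submission
  imports Defs
begin

text \<open>
  With \<open>\<X>\<close> the all-ones tensor, the entry of \<open>\<A> * \<X> * \<A>\<close> at \<open>(i, j)\<close> is \<open>1\<close> exactly when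
  \<open>\<A>\<close> has a nonzero entry \<open>(i, j')\<close> with the same row multi-index and a nonzero entry
  \<open>(i', j)\<close> with the same column multi-index. Hence the product is the smallest combinatorial
  rectangle \<open>P \<times> Q\<close> containing the support of \<open>\<A>\<close>, and it equals \<open>\<A>\<close> as soon as the support is
  itself a rectangle (\<open>regular_if_rectangular\<close>). The empty set and a singleton are rectangles,
  so a tensor of weight at most one is regular.
\<close>

lemma indices_appendE:
  assumes "l \<in> indices (I @ J)"
  obtains i j where "l = i @ j" "i \<in> indices I" "j \<in> indices J"
  using assms by (auto simp: indices_def list_all2_append2)

lemma append_in_indices:
  "i \<in> indices I \<Longrightarrow> j \<in> indices J \<Longrightarrow> i @ j \<in> indices (I @ J)"
  by (simp add: indices_def list_all2_appendI)

lemma bool_tensors_eqI: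
  assumes "A \<in> bool_tensors (I @ J)" "B \<in> bool_tensors (I @ J)"
    and "\<And>i j. i \<in> indices I \<Longrightarrow> j \<in> indices J \<Longrightarrow> A (i @ j) = B (i @ j)"
  shows "A = B"
  using assms(1,2) unfolding bool_tensors_def
  by (rule PiE_ext) (metis assms(3) indices_appendE)

lemma einstein_product_entry_iff:
  assumes "i \<in> indices I" "k \<in> indices K"
  shows "einstein_product I J K A B (i @ k) \<longleftrightarrow> (\<exists>j\<in>indices J. A (i @ j) \<and> B (j @ k))"
  by (simp add: einstein_product_entry[OF assms] sum_bool_iff finite_indices times_bool_def)

text \<open>
  The rectangle hypothesis gives \<open>\<A> * \<X> * \<A> \<le> \<A>\<close> for every \<open>\<X>\<close>; the all-ones \<open>\<X>\<close>
  gives the reverse inequality, since a nonzero entry \<open>(i, j)\<close> can serve as both outer factors.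
\<close>

lemma regular_if_rectangular:
  assumes A: "A \<in> bool_tensors (I @ J)"
    and rectangle: "\<And>i i' j j'. i \<in> indices I \<Longrightarrow> i' \<in> indices I \<Longrightarrow> j \<in> indices J \<Longrightarrow>
      j' \<in> indices J \<Longrightarrow> A (i @ j') \<Longrightarrow> A (i' @ j) \<Longrightarrow> A (i @ j)"
  shows "regular I J A"
proof -
  define X where "X = (\<lambda>l\<in>indices (J @ I). True)"
  have X: "X \<in> bool_tensors (J @ I)"
    by (auto simp: X_def bool_tensors_def one_bool_def)
  have "einstein_product I I J (einstein_product I J I A X) A = A"
  proof (rule bool_tensors_eqI[OF einstein_product_in_bool_tensors A])
    fix i j assume ij: "i \<in> indices I" "j \<in> indices J"
    have "einstein_product I I J (einstein_product I J I A X) A (i @ j) \<longleftrightarrow>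
        (\<exists>i'\<in>indices I. \<exists>j'\<in>indices J. A (i @ j') \<and> A (i' @ j))"
      using ij by (auto simp: einstein_product_entry_iff X_def append_in_indices)
    also have "\<dots> \<longleftrightarrow> A (i @ j)"
      using ij rectangle by blast
    finally show "einstein_product I I J (einstein_product I J I A X) A (i @ j) = A (i @ j)" .
  qed
  with X show ?thesis
    unfolding regular_def by blast
qed

lemma weight_le_one_unique:
  assumes "weight D A \<le> 1" "l \<in> indices D" "l' \<in> indices D" "A l" "A l'"
  shows "l = l'"
proof -
  have "finite {l \<in> indices D. A l \<noteq> 0}"
    by (simp add: finite_indices)
  with assms show ?thesis
    by (auto simp: weight_def zero_bool_def card_le_Suc0_iff_eq)
qed

theorem corollary3p12:
  fixes I J :: "nat list" and A :: "nat list \<Rightarrow> bool"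
  assumes "A \<in> bool_tensors (I @ J)"
    and "weight (I @ J) A \<le> 1"
  shows "regular I J A"
proof (rule regular_if_rectangular[OF assms(1)])
  fix i i' j j'
  assume mem: "i \<in> indices I" "i' \<in> indices I" "j \<in> indices J" "j' \<in> indices J"
    and nonzero: "A (i @ j')" "A (i' @ j)"
  have "i @ j' = i' @ j"
    using weight_le_one_unique[OF assms(2)] mem nonzero append_in_indices by blast
  moreover have "length i = length i'"
    using mem by (simp add: indices_def list_all2_lengthD)
  ultimately show "A (i @ j)"
    using nonzero by simp
qed

end
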